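(* Let $(\mathcal{H},[\cdot,\cdot])$ be a Krein space with fundamental symmetry $J$, let $\mathcal{F}=\{f_i\}_{i\in I}$ be a $J$-frame for $\mathcal{H}$ with $J$-frame operator $S$, and let $\sigma_i=\mathrm{sgn}([f_i,f_i])$. Then, for every $f\in\mathcal{H}$, \[ f=\sum_{i\in I}\sigma_i\,[f,S^{-1}f_i]\,f_i=\sum_{i\in I}\sigma_i\,[f,f_i]\,S^{-1}f_i . \]
   Context: Krein space setting: $(\mathcal{H},[\cdot,\cdot])$ is a complex separable Krein space with a fixed fundamental decomposition $\mathcal{H}=\mathcal{H}_+\dotplus\mathcal{H}_-$ (the summands are $[\cdot,\cdot]$-orthogonal and $(\mathcal{H}_\pm,\pm[\cdot,\cdot])$ are Hilbert spaces). $\langle\cdot,\cdot\rangle$ is the inner product making $\mathcal{H}$ the orthogonal direct sum of these Hilbert spaces, $\|\cdot\|$ its norm, and the fundamental symmetry $J$ (a selfadjoint unitary) satisfies $[x,y]=\langle Jx,y\rangle$. A subspace $\mathcal{S}$ is uniformly $J$-positive (resp. uniformly $J$-negative) if there is $\alpha>0$ with $[x,x]\ge\alpha\|x\|^2$ (resp. $[x,x]\le-\alpha\|x\|^2$) for all $x\in\mathcal{S}$. "Maximal" means maximal with respect to inclusion among such subspaces. A Bessel family is a family $\mathcal{F}=\{f_i\}_{i\in I}$ in $\mathcal{H}$ with $\sum_i|\langle f,f_i\rangle|^2\le B\|f\|^2$ for all $f$ and some $B<\infty$. Its synthesis operator is the bounded operator $T:\ell_2(I)\to\mathcal{H}$,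 $Te_i=f_i$, with $\{e_i\}$ the standard orthonormal basis. Let $I_+=\{i:[f_i,f_i]\ge0\}$, $I_-=\{i:[f_i,f_i]<0\}$, $P_\pm$ the orthogonal projection of $\ell_2(I)$ onto $\ell_2(I_\pm)$, and $T_\pm=TP_\pm$. The Bessel family $\mathcal{F}$ is a $J$-frame for $\mathcal{H}$ if the range $R(T_+)$ is a maximal uniformly $J$-positive subspace and $R(T_-)$ is a maximal uniformly $J$-negative subspace of $\mathcal{H}$. The $J$-frame operator of a $J$-frame $\mathcal{F}$ is the bounded operator $S:\mathcal{H}\to\mathcal{H}$, $Sf=\sum_{i\in I}\sigma_i[f,f_i]f_i$ with $\sigma_i=\mathrm{sgn}([f_i,f_i])$; it is invertible for every $J$-frame. *)

theory Defs
  imports "HOL-Analysis.Analysis"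
begin

text \<open>
  HOL-Analysis only has real inner product spaces, so the complex structure is an explicit scalar
  multiplication, and the indefinite form is linear in its first argument.
\<close>

locale krein_decomposition = vector_space scaleC
  for scaleC :: "complex \<Rightarrow> 'a::ab_group_add \<Rightarrow> 'a" +
  fixes form :: "'a \<Rightarrow> 'a \<Rightarrow> complex"
    and Hp Hm :: "'a set"
  assumes form_add: "form (x + y) z = form x z + form y z"
    and form_scale: "form (scaleC a x) y = a * form x y"
    and form_herm: "form y x = cnj (form x y)"
    and Hp_subspace: "subspace Hp"
    and Hm_subspace: "subspace Hm"
    and decomp_ex: "\<exists>p\<in>Hp. \<exists>m\<in>Hm. x = p + m"
    and decomp_direct: "Hp \<inter> Hm = {0}"
    and decomp_orth: "p \<in> Hp \<Longrightarrow> m \<in> Hm \<Longrightarrow> form p m = 0"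
    and form_pos: "p \<in> Hp \<Longrightarrow> p \<noteq> 0 \<Longrightarrow> Re (form p p) > 0"
    and form_neg: "m \<in> Hm \<Longrightarrow> m \<noteq> 0 \<Longrightarrow> Re (form m m) < 0"
begin

definition proj_p :: "'a \<Rightarrow> 'a" where
  "proj_p x = (THE p. p \<in> Hp \<and> x - p \<in> Hm)"

definition proj_m :: "'a \<Rightarrow> 'a" where
  "proj_m x = x - proj_p x"

definition J :: "'a \<Rightarrow> 'a" where
  "J x = proj_p x - proj_m x"

definition ip :: "'a \<Rightarrow> 'a \<Rightarrow> complex" where
  "ip x y = form (proj_p x) (proj_p y) - form (proj_m x) (proj_m y)"

lemma proj_p_eq:
  assumes "p \<in> Hp" "m \<in> Hm"
  shows "proj_p (p + m) = p"
  unfolding proj_p_def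
proof (rule the_equality)
  show "p \<in> Hp \<and> p + m - p \<in> Hm" using assms by simp
next
  fix q assume q: "q \<in> Hp \<and> p + m - q \<in> Hm"
  then have "q - p \<in> Hp" using assms Hp_subspace by (simp add: subspace_diff)
  moreover have "m - (p + m - q) \<in> Hm" using q assms Hm_subspace by (blast intro: subspace_diff)
  then have "q - p \<in> Hm" by (simp add: algebra_simps)
  ultimately have "q - p \<in> Hp \<inter> Hm" by blast
  then show "q = p" using decomp_direct by simp
qed

lemma proj_m_eq: "p \<in> Hp \<Longrightarrow> m \<in> Hm \<Longrightarrow> proj_m (p + m) = m"
  by (simp add: proj_m_def proj_p_eq)

lemma form_eq_ip_J: "form x y = ip (J x) y"
proof -
  obtain p m where x: "p \<in> Hp" "m \<in> Hm" "x = p + m" using decomp_ex by blast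
  obtain q n where y: "q \<in> Hp" "n \<in> Hm" "y = q + n" using decomp_ex by blast
  have m': "- m \<in> Hm" using x(2) Hm_subspace by (simp add: subspace_neg)
  have J: "J x = p + (- m)" using x by (simp add: J_def proj_p_eq proj_m_eq)
  have neg: "form (- m) n = - form m n" using form_scale[of "-1" m n] by simp
  have "form y' (q + n) = form y' q + form y' n" for y'
    by (metis form_add form_herm complex_cnj_add)
  moreover have "form m q = 0" by (metis decomp_orth form_herm complex_cnj_zero x(2) y(1))
  ultimately have "form x y = form p q + form m n"
    using x y decomp_orth by (simp add: form_add)
  moreover have "ip (J x) y = form p q - form (- m) n"
    unfolding ip_def J y(3)
    using proj_p_eq[OF x(1) m'] proj_m_eq[OF x(1) m'] proj_p_eq[OF y(1,2)] proj_m_eq[OF y(1,2)]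
    by simp
  ultimately show ?thesis by (simp add: neg)
qed

end

text \<open>
  The norm and topology come from the type class; \<open>norm_ip\<close> identifies the norm with the one
  induced by the fundamental decomposition.
\<close>

locale krein_space = krein_decomposition scaleC form Hp Hm
  for scaleC :: "complex \<Rightarrow> 'a::real_normed_vector \<Rightarrow> 'a"
    and form :: "'a \<Rightarrow> 'a \<Rightarrow> complex"
    and Hp Hm :: "'a set" +
  assumes scaleR_eq: "r *\<^sub>R x = scaleC (complex_of_real r) x"
    and norm_ip: "norm x = sqrt (Re (ip x x))"
    and complete_Hp: "complete Hp"
    and complete_Hm: "complete Hm"
    and separable: "\<exists>D :: 'a set. countable D \<and> closure D = UNIV"

definition ell2 :: "'i set \<Rightarrow> ('i \<Rightarrow> complex) set" where
  "ell2 I = {c. (\<forall>i. i \<notin> I \<longrightarrow> c i = 0) \<and> (\<lambda>i. (cmod (c i))\<^sup>2) summable_on I}"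

definition ell2_norm :: "'i set \<Rightarrow> ('i \<Rightarrow> complex) \<Rightarrow> real" where
  "ell2_norm I c = sqrt (\<Sum>\<^sub>\<infinity>i\<in>I. (cmod (c i))\<^sup>2)"

definition ell2_basis :: "'i \<Rightarrow> 'i \<Rightarrow> complex" where
  "ell2_basis i = (\<lambda>j. if j = i then 1 else 0)"

definition ell2_proj :: "'i set \<Rightarrow> ('i \<Rightarrow> complex) \<Rightarrow> 'i \<Rightarrow> complex" where
  "ell2_proj K c = (\<lambda>i. if i \<in> K then c i else 0)"

context krein_space
begin

definition uniformly_positive :: "'a set \<Rightarrow> bool" where
  "uniformly_positive M \<longleftrightarrow>
     subspace M \<and> (\<exists>\<alpha>>0. \<forall>x\<in>M. Re (form x x) \<ge> \<alpha> * (norm x)\<^sup>2)"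

definition uniformly_negative :: "'a set \<Rightarrow> bool" where
  "uniformly_negative M \<longleftrightarrow>
     subspace M \<and> (\<exists>\<alpha>>0. \<forall>x\<in>M. Re (form x x) \<le> - \<alpha> * (norm x)\<^sup>2)"

definition maximal_uniformly_positive :: "'a set \<Rightarrow> bool" where
  "maximal_uniformly_positive M \<longleftrightarrow>
     uniformly_positive M \<and> (\<forall>N. uniformly_positive N \<and> M \<subseteq> N \<longrightarrow> N = M)"

definition maximal_uniformly_negative :: "'a set \<Rightarrow> bool" where
  "maximal_uniformly_negative M \<longleftrightarrow>
     uniformly_negative M \<and> (\<forall>N. uniformly_negative N \<and> M \<subseteq> N \<longrightarrow> N = M)"

definition bessel_family :: "'i set \<Rightarrow> ('i \<Rightarrow> 'a) \<Rightarrow> bool" where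
  "bessel_family I f \<longleftrightarrow>
     (\<exists>B. \<forall>x. (\<lambda>i. (cmod (ip x (f i)))\<^sup>2) summable_on I \<and>
              (\<Sum>\<^sub>\<infinity>i\<in>I. (cmod (ip x (f i)))\<^sup>2) \<le> B * (norm x)\<^sup>2)"

text \<open>
  These conditions determine \<open>T\<close> uniquely on \<open>ell2 I\<close> (density of the finitely supported
  sequences); its values elsewhere are never used.
\<close>

definition synthesis_operator :: "'i set \<Rightarrow> ('i \<Rightarrow> 'a) \<Rightarrow> (('i \<Rightarrow> complex) \<Rightarrow> 'a) \<Rightarrow> bool" where
  "synthesis_operator I f T \<longleftrightarrow>
     (\<forall>c\<in>ell2 I. \<forall>d\<in>ell2 I. T (\<lambda>i. c i + d i) = T c + T d) \<and>
     (\<forall>a. \<forall>c\<in>ell2 I. T (\<lambda>i. a * c i) = scaleC a (T c)) \<and>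
     (\<exists>C. \<forall>c\<in>ell2 I. norm (T c) \<le> C * ell2_norm I c) \<and>
     (\<forall>i\<in>I. T (ell2_basis i) = f i)"

definition index_p :: "'i set \<Rightarrow> ('i \<Rightarrow> 'a) \<Rightarrow> 'i set" where
  "index_p I f = {i\<in>I. Re (form (f i) (f i)) \<ge> 0}"

definition index_m :: "'i set \<Rightarrow> ('i \<Rightarrow> 'a) \<Rightarrow> 'i set" where
  "index_m I f = {i\<in>I. Re (form (f i) (f i)) < 0}"

definition J_frame :: "'i set \<Rightarrow> ('i \<Rightarrow> 'a) \<Rightarrow> bool" where
  "J_frame I f \<longleftrightarrow> bessel_family I f \<and>
     (\<exists>T. synthesis_operator I f T \<and>
          maximal_uniformly_positive ((T \<circ> ell2_proj (index_p I f)) ` ell2 I) \<and>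
          maximal_uniformly_negative ((T \<circ> ell2_proj (index_m I f)) ` ell2 I))"

definition sig :: "('i \<Rightarrow> 'a) \<Rightarrow> 'i \<Rightarrow> complex" where
  "sig f i = complex_of_real (sgn (Re (form (f i) (f i))))"

definition J_frame_operator :: "'i set \<Rightarrow> ('i \<Rightarrow> 'a) \<Rightarrow> 'a \<Rightarrow> 'a" where
  "J_frame_operator I f x = (\<Sum>\<^sub>\<infinity>i\<in>I. scaleC (sig f i * form x (f i)) (f i))"

end

end

(*
  Write T = T_+ + T_- and let M_+, M_- be the ranges of T_+, T_-.  Maximality forces
  H = M_+ + M_-, a sum with a positive angle, so T is onto; by the Baire category theorem
  |x|^2 <= C * sum |[x, f_i]|^2.  If u in M_+ and v in M_- are the components of S x, this sum
  is [u - v, x], which is at most (|u| + |v|) |x| <= K |S x| |x|.  Hence S is bounded below; being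
  symmetric for [.,.], it is bijective with bounded inverse, and both expansions follow from
  S (S^-1 x) = x = S^-1 (S x).
*)

theory Submission
  imports Defs
begin

text \<open>The obstacle is indefiniteness: [S x, x] is the sum of sigma_i |[x, f_i]|^2, whose terms
  may cancel, so it gives no lower bound for S. Pairing x with u - v instead of u + v = S x makes
  every term nonnegative, and the positive angle keeps u - v within a constant multiple of S x. The
  angle also makes M_+ + M_- closed. If the sum were proper, some nonzero vector would be
  [.,.]-orthogonal to both summands, and its own sign would allow one of them to be enlarged; the
  delicate case is a neutral vector, which belongs to neither sign. A second delicate point is the
  convention at 0: a neutral f_i has sigma_i = 0 but its index lies in I_+. Such an f_i lies in M_+,
  where the form is definite, so it is the zero vector. Hilbert space arguments are carried out with
  \<open>form\<close>, \<open>J\<close> and the norm: <x, y> is \<open>form (J x) y\<close>, and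
  \<open>J\<close> turns orthogonality for one product into orthogonality for the other.\<close>

context krein_decomposition
begin

section \<open>Sesquilinearity of the form and algebra of the fundamental symmetry\<close>

lemma form_add_right: "form x (y + z) = form x y + form x z"
  by (metis form_add form_herm complex_cnj_add)

lemma form_scale_right: "form x (scaleC a y) = cnj a * form x y"
  by (metis form_scale form_herm complex_cnj_mult)

lemma form_zero_left [simp]: "form 0 y = 0"
  using form_scale[of 0 0 y] by simp

lemma form_zero_right [simp]: "form y 0 = 0"
  using form_scale_right[of y 0 0] by simp

lemma form_minus_left: "form (- x) y = - form x y"
  using form_scale[of "-1" x y] by simp

lemma form_minus_right: "form x (- y) = - form x y"
  using form_scale_right[of x "-1" y] by simp

lemma form_diff: "form (x - y) z = form x z - form y z"
  using form_add[of x "- y" z] by (simp add: form_minus_left)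

lemma form_diff_right: "form x (y - z) = form x y - form x z"
  using form_add_right[of x y "- z"] by (simp add: form_minus_right)

lemma J_decomp: "p \<in> Hp \<Longrightarrow> m \<in> Hm \<Longrightarrow> J (p + m) = p - m"
  by (simp add: J_def proj_p_eq proj_m_eq)

lemma J_add: "J (x + y) = J x + J y"
proof -
  obtain p m where x: "p \<in> Hp" "m \<in> Hm" "x = p + m" using decomp_ex by blast
  obtain q n where y: "q \<in> Hp" "n \<in> Hm" "y = q + n" using decomp_ex by blast
  have "x + y = (p + q) + (m + n)" using x y by simp
  moreover have "p + q \<in> Hp" "m + n \<in> Hm"
    using x y Hp_subspace Hm_subspace subspace_add by blast+
  ultimately have "J (x + y) = (p + q) - (m + n)" using J_decomp by metis
  then show ?thesis using x y J_decomp by simp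
qed

lemma J_scale: "J (scaleC a x) = scaleC a (J x)"
proof -
  obtain p m where x: "p \<in> Hp" "m \<in> Hm" "x = p + m" using decomp_ex by blast
  have "scaleC a p \<in> Hp" "scaleC a m \<in> Hm"
    using x Hp_subspace Hm_subspace subspace_scale by blast+
  then have "J (scaleC a x) = scaleC a p - scaleC a m"
    using J_decomp x by (simp add: scale_right_distrib)
  then show ?thesis using x J_decomp by (simp add: scale_right_diff_distrib)
qed

lemma J_J [simp]: "J (J x) = x"
proof -
  obtain p m where x: "p \<in> Hp" "m \<in> Hm" "x = p + m" using decomp_ex by blast
  have "- m \<in> Hm" using x Hm_subspace subspace_neg by blast
  then show ?thesis using x J_decomp[of p m] J_decomp[of p "- m"] by simp
qed

lemma ip_eq_form_J: "ip x y = form (J x) y"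
  by (simp add: form_eq_ip_J)

lemma form_J_left: "form (J x) y = form x (J y)"
proof -
  obtain p m where x: "p \<in> Hp" "m \<in> Hm" "x = p + m" using decomp_ex by blast
  obtain q n where y: "q \<in> Hp" "n \<in> Hm" "y = q + n" using decomp_ex by blast
  have "form p n = 0" "form m q = 0"
    using decomp_orth x y by (blast, metis decomp_orth form_herm complex_cnj_zero x(2) y(1))
  then show ?thesis
    using x y by (simp add: J_decomp form_add form_diff form_add_right form_diff_right)
qed

lemma form_J_J: "form (J x) (J y) = form x y"
  by (simp add: form_J_left)

end

section \<open>The Hilbert norm, Cauchy-Schwarz, and continuity of the form\<close>

context krein_space
begin

lemma norm_square: "(norm x)\<^sup>2 = Re (form (J x) x)"
  using norm_ip[of x] by (metis ip_eq_form_J norm_ge_zero real_sqrt_ge_0_iff real_sqrt_pow2)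

lemma norm_J [simp]: "norm (J x) = norm x"
proof -
  have "(norm (J x))\<^sup>2 = (norm x)\<^sup>2"
    by (simp add: norm_square form_J_left)
  then show ?thesis by simp
qed

lemma norm_scaleC: "norm (scaleC a x) = cmod a * norm x"
proof -
  have "(norm (scaleC a x))\<^sup>2 = Re ((a * cnj a) * form (J x) x)"
    by (simp add: norm_square J_scale form_scale form_scale_right mult_ac)
  also have "\<dots> = (cmod a)\<^sup>2 * (norm x)\<^sup>2"
    by (simp add: norm_square complex_norm_square[symmetric] flip: of_real_power)
  finally show ?thesis
    by (metis mult_nonneg_nonneg norm_ge_zero power2_eq_iff_nonneg power_mult_distrib)
qed

lemma norm_add_square:
  "(norm (x + y))\<^sup>2 = (norm x)\<^sup>2 + (norm y)\<^sup>2 + 2 * Re (form (J x) y)"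
proof -
  have "Re (form (J y) x) = Re (form (J x) y)"
    by (metis form_J_left form_herm complex_cnj cnj.simps(1))
  then show ?thesis by (simp add: norm_square J_add form_add form_add_right)
qed

lemma parallelogram_law:
  fixes x y :: 'a
  shows "(norm (x + y))\<^sup>2 + (norm (x - y))\<^sup>2 = 2 * (norm x)\<^sup>2 + 2 * (norm y)\<^sup>2"
  using norm_add_square[of x y] norm_add_square[of x "- y"] by (simp add: form_minus_right)

text \<open>Cauchy-Schwarz is read off from the triangle inequality of the type class: in the
  expansion of |J x + y|^2 the mixed term is 2 Re [x, y], because
  \<open>J (J x) = x\<close>.\<close>

lemma Re_form_le: "Re (form x y) \<le> norm x * norm y"
proof -
  have "(norm (J x + y))\<^sup>2 \<le> (norm x + norm y)\<^sup>2"
    using norm_triangle_ineq[of "J x" y] by (intro power_mono) auto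
  then show ?thesis by (simp add: norm_add_square power2_sum)
qed

lemma norm_form_le: "cmod (form x y) \<le> norm x * norm y"
proof (cases "form x y = 0")
  case False
  \<comment> \<open>A factor of modulus 1 that rotates \<open>form x y\<close> onto its modulus, so
    that the bound for real parts applies.\<close>
  define a where "a = cnj (sgn (form x y))"
  have "form (scaleC a x) y = cnj (form x y) * form x y / cmod (form x y)"
    by (simp add: a_def form_scale sgn_eq)
  also have "\<dots> = of_real (cmod (form x y))"
    using False by (simp add: mult.commute[of "cnj _"] complex_norm_square[symmetric] power2_eq_square)
  finally have "form (scaleC a x) y = of_real (cmod (form x y))" .
  then have "cmod (form x y) \<le> norm (scaleC a x) * norm y"
    using Re_form_le[of "scaleC a x" y] by simp
  also have "norm (scaleC a x) = norm x"
    using False by (simp add: a_def norm_scaleC norm_sgn)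
  finally show ?thesis .
qed simp

lemma bounded_linear_form_left: "bounded_linear (\<lambda>x. form x y)"
proof (rule bounded_linear_intro[where K = "norm y"])
  show "form (r *\<^sub>R x) y = r *\<^sub>R form x y" for r x
    by (simp add: scaleR_eq form_scale scaleR_conv_of_real)
qed (auto simp: form_add norm_form_le)

lemma bounded_linear_form_right: "bounded_linear (\<lambda>y. form x y)"
proof (rule bounded_linear_intro[where K = "norm x"])
  show "form x (r *\<^sub>R y) = r *\<^sub>R form x y" for r y
    by (simp add: scaleR_eq form_scale_right scaleR_conv_of_real)
qed (auto simp: form_add_right norm_form_le mult.commute[of _ "norm x"])

lemma bounded_linear_scaleC: "bounded_linear (scaleC a)"
proof (rule bounded_linear_intro[where K = "cmod a"])
  show "scaleC a (r *\<^sub>R x) = r *\<^sub>R scaleC a x" for r x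
    by (simp add: scaleR_eq mult.commute)
qed (auto simp: scale_right_distrib norm_scaleC mult.commute)

lemma bounded_linear_J: "bounded_linear J"
  by (rule bounded_linear_intro[where K = 1]) (auto simp: J_add J_scale scaleR_eq)

section \<open>Completeness and orthogonal complements\<close>

lemma form_eq_0_if_Re:
  assumes "subspace L" "\<And>y. y \<in> L \<Longrightarrow> Re (form x y) = 0" "y \<in> L"
  shows "form x y = 0"
proof -
  \<comment> \<open>Multiplying y by i moves the imaginary part of \<open>form x y\<close> into the
    real part.\<close>
  have "scaleC \<i> y \<in> L" using assms subspace_scale by blast
  then have "Re (form x (scaleC \<i> y)) = 0" using assms by blast
  then show ?thesis using assms by (simp add: form_scale_right complex_eq_iff)
qed

lemma complete_UNIV_krein: "complete (UNIV :: 'a set)"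
proof (rule completeI)
  fix X :: "nat \<Rightarrow> 'a"
  assume X: "Cauchy X"
  \<comment> \<open>These are the components of \<open>X n\<close> in \<open>Hp\<close> and
    \<open>Hm\<close>, written through \<open>J\<close> so that they are visibly bounded linear
    images of \<open>X n\<close> and hence Cauchy.\<close>
  define P M where "P n = (1/2) *\<^sub>R (X n + J (X n))" and "M n = (1/2) *\<^sub>R (X n - J (X n))" for n
  have decomp: "P n \<in> Hp \<and> M n \<in> Hm" for n
  proof -
    obtain p m where x: "p \<in> Hp" "m \<in> Hm" "X n = p + m" using decomp_ex by blast
    have "P n = p" "M n = m"
      using x J_decomp[of p m] unfolding P_def M_def by (simp_all flip: scaleR_2)
    then show ?thesis using x by simp
  qed
  have blP: "bounded_linear (\<lambda>x. (1/2) *\<^sub>R (x + J x))" and blM: "bounded_linear (\<lambda>x. (1/2) *\<^sub>R (x - J x))"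
    by (auto intro!: bounded_linear_intros bounded_linear_compose[OF bounded_linear_scaleR_right]
         bounded_linear_J bounded_linear_add bounded_linear_sub bounded_linear_ident)
  have "Cauchy P" "Cauchy M"
    unfolding P_def M_def
    using bounded_linear.Cauchy[OF blP X] bounded_linear.Cauchy[OF blM X] by simp_all
  then obtain p m where "P \<longlonglongrightarrow> p" "M \<longlonglongrightarrow> m"
    using complete_Hp complete_Hm decomp unfolding complete_def by blast
  then have "(\<lambda>n. P n + M n) \<longlonglongrightarrow> p + m" by (rule tendsto_add)
  moreover have "P n + M n = X n" for n
    unfolding P_def M_def by (simp add: scaleR_add_right[symmetric] flip: scaleR_2)
  ultimately show "\<exists>l\<in>UNIV. X \<longlonglongrightarrow> l" by auto
qed

text \<open>The projection theorem: the difference w of z and its nearest point in L is orthogonal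
  to L for the Hilbert product, so \<open>J w\<close> is orthogonal to L for
  \<open>form\<close>.\<close>

theorem ex_form_orthogonal:
  assumes L: "subspace L" "closed L" and z: "z \<notin> L"
  obtains u where "u \<noteq> 0" "\<And>y. y \<in> L \<Longrightarrow> form u y = 0"
proof -
  define d where "d = infdist z L"
  have ne: "L \<noteq> {}" using L subspace_0 by blast
  have d_le: "d \<le> norm (z - y)" if "y \<in> L" for y
    using infdist_le[OF that, of z] by (simp add: d_def dist_norm)
  have d0: "d \<ge> 0" by (simp add: d_def infdist_nonneg)
  have "\<exists>y\<in>L. (norm (z - y))\<^sup>2 < d\<^sup>2 + e" if "e > 0" for e
  proof -
    have "d < sqrt (d\<^sup>2 + e)"
      using that by (simp add: real_less_rsqrt)
    then obtain y where y: "y \<in> L" "dist z y < sqrt (d\<^sup>2 + e)"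
      using ne infdist_notempty[of L z] cINF_less_iff[of L "dist z"] unfolding d_def
      by (metis bdd_below_image_dist)
    then have "(norm (z - y))\<^sup>2 < (sqrt (d\<^sup>2 + e))\<^sup>2"
      by (intro power_strict_mono) (auto simp: dist_norm)
    then show ?thesis using y that by auto
  qed
  then have "\<forall>n. \<exists>y\<in>L. (norm (z - y))\<^sup>2 < d\<^sup>2 + 1 / real (Suc n)" by simp
  then obtain Y where YL: "\<And>n. Y n \<in> L" and Y: "\<And>n. (norm (z - Y n))\<^sup>2 < d\<^sup>2 + 1 / real (Suc n)"
    by metis
  \<comment> \<open>The midpoint of x and y lies in L, so its distance from z is at least d.\<close>
  have half: "d\<^sup>2 \<le> (norm ((z - x) + (z - y)))\<^sup>2 / 4" if "x \<in> L" "y \<in> L" for x y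
  proof -
    have "(1/2::real) *\<^sub>R (x + y) \<in> L"
      using that L by (metis scaleR_eq subspace_add subspace_scale)
    then have "d \<le> norm (z - (1/2::real) *\<^sub>R (x + y))" by (rule d_le)
    also have "z - (1/2::real) *\<^sub>R (x + y) = (1/2::real) *\<^sub>R ((z - x) + (z - y))"
      by (simp add: algebra_simps flip: scaleR_2 scaleR_left_distrib)
    finally have "2 * d \<le> norm ((z - x) + (z - y))" by simp
    then have "(2 * d)\<^sup>2 \<le> (norm ((z - x) + (z - y)))\<^sup>2"
      using d0 by (intro power_mono) auto
    then show ?thesis by (simp add: power_mult_distrib)
  qed
  \<comment> \<open>In the parallelogram law the two squared distances contribute at most 4 d^2 plus
    the error terms, and \<open>half\<close> removes exactly 4 d^2.\<close>
  have near: "(norm (Y m - Y n))\<^sup>2 \<le> 2 / real (Suc m) + 2 / real (Suc n)" for m n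
    using parallelogram_law[of "z - Y m" "z - Y n"] half[OF YL YL, of m n] Y[of m] Y[of n]
    by (simp add: norm_minus_commute)
  have "Cauchy Y"
  proof (rule metric_CauchyI)
    fix e :: real assume e: "e > 0"
    obtain N where N: "1 / real (Suc N) < e\<^sup>2 / 4"
      using nat_approx_posE[of "e\<^sup>2 / 4"] e by auto
    have "dist (Y m) (Y n) < e" if "m \<ge> N" "n \<ge> N" for m n
    proof -
      have "1 / real (Suc m) \<le> 1 / real (Suc N)" "1 / real (Suc n) \<le> 1 / real (Suc N)"
        using that by (auto simp: field_simps)
      then have "(norm (Y m - Y n))\<^sup>2 < e\<^sup>2" using near[of m n] N by simp
      then show ?thesis using e by (simp add: dist_norm power2_less_imp_less)
    qed
    then show "\<exists>M. \<forall>m\<ge>M. \<forall>n\<ge>M. dist (Y m) (Y n) < e" by blast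
  qed
  then obtain y where lim: "Y \<longlonglongrightarrow> y"
    using complete_UNIV_krein by (meson UNIV_I completeE)
  then have y: "y \<in> L" using L YL closed_sequentially by blast
  have "(\<lambda>n. (norm (z - Y n))\<^sup>2) \<longlonglongrightarrow> (norm (z - y))\<^sup>2"
    by (intro tendsto_intros lim)
  moreover have "(\<lambda>n. d\<^sup>2 + 1 / real (Suc n)) \<longlonglongrightarrow> d\<^sup>2 + 0"
    by (intro tendsto_intros LIMSEQ_inverse_real_of_nat[unfolded inverse_eq_divide])
  ultimately have min: "(norm (z - y))\<^sup>2 \<le> d\<^sup>2"
    using Y by (intro LIMSEQ_le[of "\<lambda>n. (norm (z - Y n))\<^sup>2" _ "\<lambda>n. d\<^sup>2 + 1 / real (Suc n)"])
      (auto intro: less_imp_le)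
  define w where "w = z - y"
  have "Re (form (J w) x) = 0" if x: "x \<in> L" for x
  proof (rule ccontr)
    define a where "a = Re (form (J w) x)"
    assume "Re (form (J w) x) \<noteq> 0"
    then have a: "a \<noteq> 0" "x \<noteq> 0" by (auto simp: a_def)
    \<comment> \<open>The minimiser of |w - t x|^2 over real t; it lowers the squared distance by
      a^2 / |x|^2, contradicting the choice of y.\<close>
    define t where "t = a / (norm x)\<^sup>2"
    have "y + t *\<^sub>R x \<in> L" using L x y by (simp add: scaleR_eq subspace_add subspace_scale)
    then have "d \<le> norm (w + (- t) *\<^sub>R x)"
      using d_le[of "y + t *\<^sub>R x"] by (simp add: w_def algebra_simps)
    then have "d\<^sup>2 \<le> (norm (w + (- t) *\<^sub>R x))\<^sup>2" using d0 by (intro power_mono) auto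
    also have "\<dots> = (norm w)\<^sup>2 + (norm ((- t) *\<^sub>R x))\<^sup>2 + 2 * Re (form (J w) ((- t) *\<^sub>R x))"
      by (rule norm_add_square)
    also have "\<dots> = (norm w)\<^sup>2 + t\<^sup>2 * (norm x)\<^sup>2 - 2 * t * a"
      unfolding scaleR_eq norm_scaleC form_scale_right by (simp add: a_def power_mult_distrib)
    also have "\<dots> = (norm w)\<^sup>2 - a\<^sup>2 / (norm x)\<^sup>2"
      using a by (simp add: t_def field_simps power2_eq_square)
    finally have "a\<^sup>2 / (norm x)\<^sup>2 \<le> 0" using min by (simp add: w_def)
    then show False using a by (simp add: divide_le_0_iff)
  qed
  then have "\<And>x. x \<in> L \<Longrightarrow> form (J w) x = 0"
    using form_eq_0_if_Re[OF L(1)] by blast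
  moreover have "J w \<noteq> 0" using y z w_def by (metis eq_iff_diff_eq_0 norm_J norm_eq_zero)
  ultimately show ?thesis using that by blast
qed

section \<open>Maximal uniformly definite subspaces and the sum of two of opposite sign\<close>

text \<open>
  The sign \<open>s\<close> ranges over \<open>1\<close> and \<open>-1\<close>, so that both definite cases are treated at once.
\<close>

definition uniformly_definite :: "real \<Rightarrow> 'a set \<Rightarrow> bool" where
  "uniformly_definite s M \<longleftrightarrow>
     subspace M \<and> (\<exists>\<alpha>>0. \<forall>x\<in>M. s * Re (form x x) \<ge> \<alpha> * (norm x)\<^sup>2)"

definition maximal_uniformly_definite :: "real \<Rightarrow> 'a set \<Rightarrow> bool" where
  "maximal_uniformly_definite s M \<longleftrightarrow>
     uniformly_definite s M \<and> (\<forall>N. uniformly_definite s N \<and> M \<subseteq> N \<longrightarrow> N = M)"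

lemma maximal_uniformly_positive_iff:
  "maximal_uniformly_positive M \<longleftrightarrow> maximal_uniformly_definite 1 M"
  by (simp add: maximal_uniformly_positive_def maximal_uniformly_definite_def
      uniformly_positive_def uniformly_definite_def)

lemma maximal_uniformly_negative_iff:
  "maximal_uniformly_negative M \<longleftrightarrow> maximal_uniformly_definite (- 1) M"
proof -
  have "uniformly_negative N \<longleftrightarrow> uniformly_definite (- 1) N" for N
    unfolding uniformly_negative_def uniformly_definite_def
    by (simp add: le_minus_iff[of "_ * _"] minus_le_iff) 
  then show ?thesis
    by (simp add: maximal_uniformly_negative_def maximal_uniformly_definite_def)
qed

lemma subspace_closure:
  assumes "subspace M"
  shows "subspace (closure M)"
proof (rule subspaceI)
  show "0 \<in> closure M" using assms subspace_0 closure_subset by blast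
next
  fix x y assume "x \<in> closure M" "y \<in> closure M"
  then obtain X Y where "\<And>n. X n \<in> M" "X \<longlonglongrightarrow> x" "\<And>n. Y n \<in> M" "Y \<longlonglongrightarrow> y"
    unfolding closure_sequential by blast
  then have "\<forall>n. X n + Y n \<in> M" "(\<lambda>n. X n + Y n) \<longlonglongrightarrow> x + y"
    using assms by (auto intro: subspace_add tendsto_add)
  then show "x + y \<in> closure M" unfolding closure_sequential by (intro exI[of _ "\<lambda>n. X n + Y n"]) simp
next
  fix c x assume "x \<in> closure M"
  then obtain X where "\<And>n. X n \<in> M" "X \<longlonglongrightarrow> x" unfolding closure_sequential by blast
  then have "\<forall>n. scaleC c (X n) \<in> M" "(\<lambda>n. scaleC c (X n)) \<longlonglongrightarrow> scaleC c x"
    using assms by (auto intro: subspace_scale bounded_linear.tendsto[OF bounded_linear_scaleC])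
  then show "scaleC c x \<in> closure M"
    unfolding closure_sequential by (intro exI[of _ "\<lambda>n. scaleC c (X n)"]) simp
qed

lemma tendsto_form_self:
  assumes "(X \<longlongrightarrow> x) F"
  shows "((\<lambda>n. form (X n) (X n)) \<longlongrightarrow> form x x) F"
proof -
  have "bounded_bilinear form"
    by (rule bounded_bilinear.intro)
      (auto simp: form_add form_add_right scaleR_eq form_scale form_scale_right scaleR_conv_of_real
        norm_form_le intro!: exI[of _ 1])
  then show ?thesis using bounded_bilinear.tendsto assms by blast
qed

text \<open>The definiteness estimate passes to limits with the same constant, so the closure is a
  competitor in the maximality of M.\<close>

lemma maximal_uniformly_definite_closed:
  assumes "maximal_uniformly_definite s M"
  shows "closed M"
proof -
  obtain \<alpha> where M: "subspace M" "\<alpha> > 0" "\<And>x. x \<in> M \<Longrightarrow> \<alpha> * (norm x)\<^sup>2 \<le> s * Re (form x x)"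
    using assms unfolding maximal_uniformly_definite_def uniformly_definite_def by blast
  have "\<alpha> * (norm x)\<^sup>2 \<le> s * Re (form x x)" if x: "x \<in> closure M" for x
  proof -
    obtain X where X: "\<And>n. X n \<in> M" "X \<longlonglongrightarrow> x"
      using x unfolding closure_sequential by blast
    show ?thesis
    proof (rule LIMSEQ_le)
      show "(\<lambda>n. \<alpha> * (norm (X n))\<^sup>2) \<longlonglongrightarrow> \<alpha> * (norm x)\<^sup>2"
        "(\<lambda>n. s * Re (form (X n) (X n))) \<longlonglongrightarrow> s * Re (form x x)"
        by (intro tendsto_intros tendsto_form_self X)+
    qed (use M X in auto)
  qed
  then have "uniformly_definite s (closure M)"
    unfolding uniformly_definite_def using M subspace_closure by blast
  then have "closure M = M"
    using assms closure_subset unfolding maximal_uniformly_definite_def by blast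
  then show ?thesis by (metis closed_closure)
qed

text \<open>
  Otherwise \<open>M\<close> could be enlarged by \<open>v = u + \<alpha> s J u\<close>, where \<open>\<alpha>\<close> is a constant of uniform
  definiteness of \<open>M\<close>: the perturbation makes \<open>v\<close> strictly definite even if \<open>u\<close> is neutral.
\<close>

lemma form_orthogonal_maximal_eq_0:
  assumes s: "s = 1 \<or> s = - 1" and max: "maximal_uniformly_definite s M"
    and orth: "\<And>x. x \<in> M \<Longrightarrow> form u x = 0" and u: "s * Re (form u u) \<ge> 0"
  shows "u = 0"
proof (rule ccontr)
  assume u0: "u \<noteq> 0"
  obtain \<alpha> where M: "subspace M" "\<alpha> > 0" "\<And>x. x \<in> M \<Longrightarrow> \<alpha> * (norm x)\<^sup>2 \<le> s * Re (form x x)"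
    using max unfolding maximal_uniformly_definite_def uniformly_definite_def by blast
  have ss: "s * s = 1" using s by auto
  \<comment> \<open>Perturbing by exactly alpha balances the terms of [x + a v, x + a v]: with t =
    |a| |u|, the mixed term is at most 2 alpha |x| t, against alpha |x|^2 + 2 alpha t^2 from the
    squares, and the resulting quadratic form is positive definite.\<close>
  define e where "e = complex_of_real (\<alpha> * s)"
  define v where "v = u + scaleC e (J u)"
  have orth': "form x u = 0" if "x \<in> M" for x
    using orth[OF that] form_herm[of x u] by (metis complex_cnj_zero form_herm)
  have xv: "cmod (form x v) \<le> \<alpha> * norm x * norm u" if "x \<in> M" for x
  proof -
    have "cmod (form x v) = \<alpha> * cmod (form x (J u))"
      using orth'[OF that] s M(2) by (auto simp: v_def form_add_right form_scale_right e_def norm_mult)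
    also have "\<dots> \<le> \<alpha> * (norm x * norm u)"
      using M(2) norm_form_le[of x "J u"] by (intro mult_left_mono) auto
    finally show ?thesis by simp
  qed
  \<comment> \<open>The two mixed terms e [J u, u] contribute 2 alpha |u|^2 after multiplication by
    s; the terms with [u, u] are nonnegative by the assumption on u.\<close>
  have vv: "s * Re (form v v) \<ge> 2 * \<alpha> * (norm u)\<^sup>2"
  proof -
    have "form v v = form u u + e * form (J u) u + e * form (J u) u + e * e * form u u"
      unfolding v_def
      by (simp add: form_add form_add_right form_scale form_scale_right form_J_J form_J_left[of u u, symmetric]
          e_def algebra_simps)
    then have "Re (form v v) = Re (form u u) + 2 * (\<alpha> * s) * (norm u)\<^sup>2 + (\<alpha> * s) * (\<alpha> * s) * Re (form u u)"
      by (simp add: e_def norm_square flip: of_real_mult)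
    then have "s * Re (form v v) = s * Re (form u u) + 2 * \<alpha> * (s * s) * (norm u)\<^sup>2
        + \<alpha> * \<alpha> * (s * s) * (s * Re (form u u))" by (simp add: algebra_simps)
    then show ?thesis using u ss by simp
  qed
  have nv: "norm v \<le> (1 + \<alpha>) * norm u"
  proof -
    have "norm v \<le> norm u + cmod e * norm u"
      unfolding v_def by (metis norm_J norm_scaleC norm_triangle_ineq)
    also have "cmod e = \<alpha>" using s M(2) by (auto simp: e_def)
    finally show ?thesis by (simp add: algebra_simps)
  qed
  define N where "N = {x + scaleC a v | x a. x \<in> M}"
  have "subspace N"
  proof (rule subspaceI)
    show "0 \<in> N" unfolding N_def using subspace_0[OF M(1)] by (auto intro!: exI[of _ 0])
  next
    fix x y assume "x \<in> N" "y \<in> N"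
    then obtain x' a y' b where "x = x' + scaleC a v" "y = y' + scaleC b v" "x' \<in> M" "y' \<in> M"
      unfolding N_def by blast
    then have "x + y = (x' + y') + scaleC (a + b) v" "x' + y' \<in> M"
      using M(1) by (auto simp: scale_left_distrib subspace_add)
    then show "x + y \<in> N" unfolding N_def by blast
  next
    fix c x assume "x \<in> N"
    then obtain x' a where "x = x' + scaleC a v" "x' \<in> M" unfolding N_def by blast
    then have "scaleC c x = scaleC c x' + scaleC (c * a) v" "scaleC c x' \<in> M"
      using M(1) by (auto simp: scale_right_distrib subspace_scale)
    then show "scaleC c x \<in> N" unfolding N_def by blast
  qed
  \<comment> \<open>The constant is the quotient of alpha / 3, from the lower bound for s [w, w],
    and 2 (1 + alpha)^2, from the upper bound for |w|^2, both relative to |x|^2 + t^2.\<close>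
  moreover have "\<alpha> / (6 * (1 + \<alpha>)\<^sup>2) * (norm w)\<^sup>2 \<le> s * Re (form w w)" if wN: "w \<in> N" for w
  proof -
    obtain x a where w: "w = x + scaleC a v" "x \<in> M" using wN unfolding N_def by blast
    define t where "t = cmod a * norm u"
    have t: "t \<ge> 0" by (simp add: t_def)
    have eq: "form w w = form x x + (cnj a * form x v + cnj (cnj a * form x v)) + (a * cnj a) * form v v"
      using form_herm[of v x]
      by (simp add: w form_add form_add_right form_scale form_scale_right algebra_simps)
    have "Re (form w w) = Re (form x x) + 2 * Re (cnj a * form x v) + (cmod a)\<^sup>2 * Re (form v v)"
      unfolding eq complex_norm_square[symmetric] by (simp flip: of_real_power)
    then have "s * Re (form w w) = s * Re (form x x) + 2 * (s * Re (cnj a * form x v)) + (cmod a)\<^sup>2 * (s * Re (form v v))"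
      by (simp add: algebra_simps)
    moreover have "s * Re (cnj a * form x v) \<ge> - (\<alpha> * norm x * t)"
    proof -
      have "\<bar>s * Re (cnj a * form x v)\<bar> \<le> cmod (cnj a * form x v)"
        using s abs_Re_le_cmod[of "cnj a * form x v"] by auto
      also have "\<dots> \<le> cmod a * (\<alpha> * norm x * norm u)"
        using xv[OF w(2)] by (simp add: norm_mult mult_left_mono)
      finally show ?thesis by (simp add: t_def algebra_simps)
    qed
    moreover have "(cmod a)\<^sup>2 * (s * Re (form v v)) \<ge> (cmod a)\<^sup>2 * (2 * \<alpha> * (norm u)\<^sup>2)"
      using vv by (intro mult_left_mono) auto
    ultimately have "s * Re (form w w) \<ge> \<alpha> * ((norm x)\<^sup>2 - 2 * norm x * t + 2 * t\<^sup>2)"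
      using M(3)[OF w(2)] by (simp add: t_def power_mult_distrib algebra_simps)
    \<comment> \<open>The least eigenvalue of this quadratic form in |x| and t is (3 - sqrt 5) / 2,
      which exceeds 1/3; the value 1/3 makes the completed square simple.\<close>
    moreover have "(norm x)\<^sup>2 - 2 * norm x * t + 2 * t\<^sup>2 \<ge> ((norm x)\<^sup>2 + t\<^sup>2) / 3"
    proof -
      have "3 * ((norm x)\<^sup>2 - 2 * norm x * t + 2 * t\<^sup>2) - ((norm x)\<^sup>2 + t\<^sup>2)
          = 2 * (norm x - 3/2 * t)\<^sup>2 + t\<^sup>2 / 2"
        by (simp add: power2_eq_square algebra_simps)
      also have "\<dots> \<ge> 0" by simp
      finally show ?thesis by simp
    qed
    ultimately have low: "s * Re (form w w) \<ge> \<alpha> * (((norm x)\<^sup>2 + t\<^sup>2) / 3)"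
      using M(2) by (meson mult_left_mono less_imp_le order_trans)
    have "norm w \<le> norm x + cmod a * norm v"
      unfolding w by (metis norm_scaleC norm_triangle_ineq)
    also have "\<dots> \<le> norm x + cmod a * ((1 + \<alpha>) * norm u)"
      using nv by (intro add_left_mono mult_left_mono) auto
    also have "\<dots> \<le> (1 + \<alpha>) * (norm x + t)"
      using M(2) by (simp add: t_def algebra_simps)
    finally have "(norm w)\<^sup>2 \<le> ((1 + \<alpha>) * (norm x + t))\<^sup>2" by (intro power_mono) auto
    also have "\<dots> \<le> (1 + \<alpha>)\<^sup>2 * (2 * ((norm x)\<^sup>2 + t\<^sup>2))"
      unfolding power_mult_distrib
      using sum_squares_bound[of "norm x" t]
      by (intro mult_left_mono zero_le_power2) (simp add: power2_sum)
    finally have "\<alpha> / (6 * (1 + \<alpha>)\<^sup>2) * (norm w)\<^sup>2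
        \<le> \<alpha> / (6 * (1 + \<alpha>)\<^sup>2) * ((1 + \<alpha>)\<^sup>2 * (2 * ((norm x)\<^sup>2 + t\<^sup>2)))"
      using M(2) by (intro mult_left_mono) auto
    also have "\<dots> = \<alpha> * (((norm x)\<^sup>2 + t\<^sup>2) / 3)"
      using M(2) by (simp add: divide_simps)
    finally show ?thesis using low by simp
  qed
  moreover have "\<alpha> / (6 * (1 + \<alpha>)\<^sup>2) > 0" using M(2) by simp
  ultimately have "uniformly_definite s N"
    unfolding uniformly_definite_def by blast
  moreover have "M \<subseteq> N"
  proof
    fix x assume "x \<in> M"
    then have "x = x + scaleC 0 v \<and> x \<in> M" by simp
    then show "x \<in> N" unfolding N_def by blast
  qed
  ultimately have "N = M" using max unfolding maximal_uniformly_definite_def by blast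
  \<comment> \<open>Now v lies in M, so [u, v] = 0. But s [u, v] = s [u, u] + alpha |u|^2 is
    positive.\<close>
  moreover have "0 + scaleC 1 v \<in> N" unfolding N_def using subspace_0[OF M(1)] by blast
  ultimately have "form u v = 0" using orth by simp
  moreover have "form u v = form u u + e * form (J u) u"
    unfolding v_def by (simp add: form_add_right form_scale_right form_J_left e_def)
  ultimately have "0 = s * (Re (form u u) + (\<alpha> * s) * (norm u)\<^sup>2)"
    by (simp add: e_def norm_square complex_eq_iff)
  also have "\<dots> = s * Re (form u u) + \<alpha> * (s * s) * (norm u)\<^sup>2" by (simp add: algebra_simps)
  finally show False using u ss u0 M(2) by (smt (verit) mult_pos_pos mult.right_neutral zero_less_norm_iff zero_less_power)
qed

text \<open>The positive angle. Definiteness bounds [u, u] - [v, v] from below by c (|u|^2 + |v|^2);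
  the same number is Re [u + v, u - v], at most |u + v| (|u| + |v|).\<close>

lemma norm_add_uniformly_definite_ge:
  assumes "uniformly_definite 1 M" "uniformly_definite (- 1) N"
  obtains K where "K > 0" "\<And>u v. u \<in> M \<Longrightarrow> v \<in> N \<Longrightarrow> norm u + norm v \<le> K * norm (u + v)"
proof -
  obtain a where a: "a > 0" "\<And>x. x \<in> M \<Longrightarrow> a * (norm x)\<^sup>2 \<le> Re (form x x)"
    using assms unfolding uniformly_definite_def by auto
  obtain b where b: "b > 0" "\<And>x. x \<in> N \<Longrightarrow> b * (norm x)\<^sup>2 \<le> - Re (form x x)"
    using assms unfolding uniformly_definite_def by auto
  define c where "c = min a b"
  have c: "c > 0" using a(1) b(1) by (simp add: c_def)
  have "norm u + norm v \<le> 2 / c * norm (u + v)" if uv: "u \<in> M" "v \<in> N" for u v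
  proof -
    define q where "q = norm u + norm v"
    have "c * (norm u)\<^sup>2 \<le> a * (norm u)\<^sup>2" "c * (norm v)\<^sup>2 \<le> b * (norm v)\<^sup>2"
      by (intro mult_right_mono zero_le_power2, simp add: c_def)+
    then have "c * ((norm u)\<^sup>2 + (norm v)\<^sup>2) \<le> Re (form u u) - Re (form v v)"
      using a(2)[OF uv(1)] b(2)[OF uv(2)] by (simp add: distrib_left)
    also have "\<dots> = Re (form (u + v) u) - Re (form (u + v) v)"
    proof -
      have "Re (form v u) = Re (form u v)" by (subst form_herm) simp
      then show ?thesis by (simp add: form_add)
    qed
    also have "\<dots> = Re (form (u + v) (u - v))" by (simp add: form_diff_right)
    also have "\<dots> \<le> norm (u + v) * norm (u - v)" by (rule Re_form_le)
    also have "\<dots> \<le> norm (u + v) * q"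
      unfolding q_def by (intro mult_left_mono norm_triangle_ineq4) auto
    finally have low: "c * ((norm u)\<^sup>2 + (norm v)\<^sup>2) \<le> norm (u + v) * q" .
    have "q\<^sup>2 \<le> 2 * ((norm u)\<^sup>2 + (norm v)\<^sup>2)"
      unfolding q_def using sum_squares_bound[of "norm u" "norm v"] by (simp add: power2_sum)
    then have "c * q\<^sup>2 \<le> c * (2 * ((norm u)\<^sup>2 + (norm v)\<^sup>2))"
      using c by (intro mult_left_mono) auto
    with low have "(c * q) * q \<le> (2 * norm (u + v)) * q"
      by (simp add: power2_eq_square algebra_simps)
    moreover have "q \<ge> 0" by (simp add: q_def)
    ultimately have "c * q \<le> 2 * norm (u + v)"
      by (cases "q = 0") (auto simp: mult_le_cancel_right)
    then show ?thesis using c unfolding q_def[symmetric] by (simp add: pos_le_divide_eq mult.commute)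
  qed
  moreover have "2 / c > 0" using c by simp
  ultimately show ?thesis using that by blast
qed

lemma maximal_definite_sum_UNIV:
  assumes M: "maximal_uniformly_definite 1 M" and N: "maximal_uniformly_definite (- 1) N"
  obtains u v where "u \<in> M" "v \<in> N" "z = u + v"
proof -
  have uM: "uniformly_definite 1 M" and uN: "uniformly_definite (- 1) N"
    using M N by (simp_all add: maximal_uniformly_definite_def)
  obtain K where K: "K > 0" "\<And>u v. u \<in> M \<Longrightarrow> v \<in> N \<Longrightarrow> norm u + norm v \<le> K * norm (u + v)"
    using norm_add_uniformly_definite_ge[OF uM uN] by blast
  have sM: "subspace M" and sN: "subspace N" using uM uN by (auto simp: uniformly_definite_def)
  define L where "L = {u + v | u v. u \<in> M \<and> v \<in> N}"
  have L: "subspace L"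
    unfolding L_def using subspace_sums[OF sM sN] by simp
  have "closed L"
    unfolding closed_sequential_limits
  proof (intro allI impI, elim conjE)
    fix X l assume "\<forall>n. X n \<in> L" and X: "X \<longlonglongrightarrow> l"
    then obtain U V where UV: "\<And>n. U n \<in> M" "\<And>n. V n \<in> N" "\<And>n. X n = U n + V n"
      unfolding L_def mem_Collect_eq by metis
    \<comment> \<open>The angle bound applied to differences: if the sums form a Cauchy sequence, so
      do both components.\<close>
    have le: "norm (U m - U n) + norm (V m - V n) \<le> K * norm (X m - X n)" for m n
      using K(2)[of "U m - U n" "V m - V n"] subspace_diff[OF sM UV(1) UV(1)] subspace_diff[OF sN UV(2) UV(2)]
      by (simp add: UV(3) algebra_simps)
    have "Cauchy X" using X LIMSEQ_imp_Cauchy by blast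
    have "Cauchy U \<and> Cauchy V"
    proof (intro conjI metric_CauchyI)
      fix e :: real assume e: "e > 0"
      then have "e / K > 0" using K(1) by simp
      then obtain n0 where n0: "\<forall>m\<ge>n0. \<forall>n\<ge>n0. dist (X m) (X n) < e / K"
        using metric_CauchyD[OF \<open>Cauchy X\<close>] by blast
      have "norm (U m - U n) < e \<and> norm (V m - V n) < e" if "m \<ge> n0" "n \<ge> n0" for m n
      proof -
        have "norm (X m - X n) < e / K" using n0 that by (simp add: dist_norm)
        then have "K * norm (X m - X n) < e" using K(1) by (simp add: pos_less_divide_eq mult.commute)
        then show ?thesis
          using le[of m n] norm_ge_zero[of "U m - U n"] norm_ge_zero[of "V m - V n"] by linarith
      qed
      then show "\<exists>k. \<forall>m\<ge>k. \<forall>n\<ge>k. dist (U m) (U n) < e" "\<exists>k. \<forall>m\<ge>k. \<forall>n\<ge>k. dist (V m) (V n) < e"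
        unfolding dist_norm by blast+
    qed
    then obtain u v where uv: "U \<longlonglongrightarrow> u" "V \<longlonglongrightarrow> v"
      using complete_UNIV_krein by (meson UNIV_I completeE)
    then have "u \<in> M" "v \<in> N"
      using UV maximal_uniformly_definite_closed[OF M] maximal_uniformly_definite_closed[OF N]
      by (auto intro: closed_sequentially)
    moreover have "l = u + v"
      using LIMSEQ_unique[OF X] tendsto_add[OF uv] by (simp add: UV(3)[symmetric])
    ultimately show "l \<in> L" unfolding L_def by blast
  qed
  have "z \<in> L"
  proof (rule ccontr)
    assume "z \<notin> L"
    then obtain u where u: "u \<noteq> 0" "\<And>y. y \<in> L \<Longrightarrow> form u y = 0"
      using ex_form_orthogonal[OF L \<open>closed L\<close>] by blast
    have "M \<subseteq> L" "N \<subseteq> L"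
      unfolding L_def using subspace_0[OF sM] subspace_0[OF sN] by force+
    then have "\<And>y. y \<in> M \<Longrightarrow> form u y = 0" "\<And>y. y \<in> N \<Longrightarrow> form u y = 0" using u(2) by blast+
    \<comment> \<open>Whatever the sign of [u, u], one of the two maximal subspaces forces u = 0; a
      neutral u is excluded by either.\<close>
    moreover have "1 * Re (form u u) \<ge> 0 \<or> - 1 * Re (form u u) \<ge> 0" by auto
    ultimately show False
      using form_orthogonal_maximal_eq_0[OF _ M] form_orthogonal_maximal_eq_0[OF _ N] u(1) by blast
  qed
  then show ?thesis using that unfolding L_def by blast
qed

end

section \<open>Square-summable families: Cauchy-Schwarz, linear structure, truncation\<close>

lemma has_sum_mult_norm_le:
  fixes a b :: "'i \<Rightarrow> complex"
  assumes "((\<lambda>i. a i * b i) has_sum s) I"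
    and a: "(\<lambda>i. (cmod (a i))\<^sup>2) summable_on I" and b: "(\<lambda>i. (cmod (b i))\<^sup>2) summable_on I"
  shows "cmod s \<le> sqrt (\<Sum>\<^sub>\<infinity>i\<in>I. (cmod (a i))\<^sup>2) * sqrt (\<Sum>\<^sub>\<infinity>i\<in>I. (cmod (b i))\<^sup>2)"
proof (rule tendsto_upperbound)
  show "((\<lambda>F. cmod (\<Sum>i\<in>F. a i * b i)) \<longlongrightarrow> cmod s) (finite_subsets_at_top I)"
    using assms(1) unfolding has_sum_def by (rule tendsto_norm)
  show "\<forall>\<^sub>F F in finite_subsets_at_top I. cmod (\<Sum>i\<in>F. a i * b i)
      \<le> sqrt (\<Sum>\<^sub>\<infinity>i\<in>I. (cmod (a i))\<^sup>2) * sqrt (\<Sum>\<^sub>\<infinity>i\<in>I. (cmod (b i))\<^sup>2)"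
  proof (rule eventually_finite_subsets_at_top_weakI)
    fix F assume F: "finite F" "F \<subseteq> I"
    have "cmod (\<Sum>i\<in>F. a i * b i) \<le> (\<Sum>i\<in>F. \<bar>cmod (a i)\<bar> * \<bar>cmod (b i)\<bar>)"
      by (rule order_trans[OF norm_sum]) (simp add: norm_mult)
    also have "\<dots> \<le> L2_set (\<lambda>i. cmod (a i)) F * L2_set (\<lambda>i. cmod (b i)) F"
      by (rule L2_set_mult_ineq)
    also have "\<dots> \<le> sqrt (\<Sum>\<^sub>\<infinity>i\<in>I. (cmod (a i))\<^sup>2) * sqrt (\<Sum>\<^sub>\<infinity>i\<in>I. (cmod (b i))\<^sup>2)"
      unfolding L2_set_def
      by (intro mult_mono real_sqrt_le_mono finite_sum_le_infsum a b F real_sqrt_ge_zero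
          sum_nonneg infsum_nonneg) auto
    finally show "cmod (\<Sum>i\<in>F. a i * b i)
      \<le> sqrt (\<Sum>\<^sub>\<infinity>i\<in>I. (cmod (a i))\<^sup>2) * sqrt (\<Sum>\<^sub>\<infinity>i\<in>I. (cmod (b i))\<^sup>2)" .
  qed
qed simp

lemma ell2_summable: "c \<in> ell2 I \<Longrightarrow> (\<lambda>i. (cmod (c i))\<^sup>2) summable_on I"
  by (simp add: ell2_def)

lemma ell2_mult: "c \<in> ell2 I \<Longrightarrow> (\<lambda>i. a * c i) \<in> ell2 I"
  by (auto simp: ell2_def norm_mult power_mult_distrib intro: summable_on_cmult_right)

lemma ell2_proj_in_ell2:
  assumes "c \<in> ell2 I"
  shows "ell2_proj K c \<in> ell2 I"
proof -
  have "(\<lambda>i. (cmod (ell2_proj K c i))\<^sup>2) summable_on I"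
    by (rule summable_on_comparison_test[OF ell2_summable[OF assms]]) (auto simp: ell2_proj_def)
  then show ?thesis using assms by (auto simp: ell2_def ell2_proj_def)
qed

lemma ell2_add:
  assumes "c \<in> ell2 I" "d \<in> ell2 I"
  shows "(\<lambda>i. c i + d i) \<in> ell2 I"
proof -
  have le: "(cmod (c i + d i))\<^sup>2 \<le> 2 * (cmod (c i))\<^sup>2 + 2 * (cmod (d i))\<^sup>2" for i
  proof -
    have "(cmod (c i + d i))\<^sup>2 \<le> (cmod (c i) + cmod (d i))\<^sup>2"
      by (intro power_mono norm_triangle_ineq) auto
    also have "\<dots> \<le> 2 * (cmod (c i))\<^sup>2 + 2 * (cmod (d i))\<^sup>2"
      using sum_squares_bound[of "cmod (c i)" "cmod (d i)"] by (simp add: power2_sum)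
    finally show ?thesis .
  qed
  have "(\<lambda>i. (cmod (c i + d i))\<^sup>2) summable_on I"
  proof (rule summable_on_comparison_test)
    show "(\<lambda>i. 2 * (cmod (c i))\<^sup>2 + 2 * (cmod (d i))\<^sup>2) summable_on I"
      using assms by (intro summable_on_add summable_on_cmult_right ell2_summable)
  qed (use le in auto)
  then show ?thesis using assms by (auto simp: ell2_def)
qed

lemma ell2_diff: "c \<in> ell2 I \<Longrightarrow> d \<in> ell2 I \<Longrightarrow> (\<lambda>i. c i - d i) \<in> ell2 I"
  using ell2_add[of c I "\<lambda>i. - 1 * d i"] ell2_mult[of d I "- 1"] by simp

lemma ell2_basis_in_ell2: "i \<in> I \<Longrightarrow> ell2_basis i \<in> ell2 I"
  using has_sum_finite_neutralI[of "{i}" I "\<lambda>j. (cmod (ell2_basis i j))\<^sup>2" 1]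
  by (auto simp: ell2_def ell2_basis_def dest: has_sum_imp_summable)

text \<open>The right-hand side tends to 0 as F grows, so truncations converge in norm; this is how
  density of the finitely supported sequences enters.\<close>

lemma ell2_norm_cutoff:
  assumes c: "c \<in> ell2 I" and F: "finite F" "F \<subseteq> I"
  shows "ell2_norm I (\<lambda>i. c i - ell2_proj F c i)
    = sqrt ((\<Sum>\<^sub>\<infinity>i\<in>I. (cmod (c i))\<^sup>2) - (\<Sum>i\<in>F. (cmod (c i))\<^sup>2))"
proof -
  let ?g = "\<lambda>i. (cmod (c i))\<^sup>2"
  have "((\<lambda>i. if i \<in> F then - ?g i else 0) has_sum (- sum ?g F)) I"
    using F by (intro has_sum_finite_neutralI[of F]) (auto simp: sum_negf)
  then have "((\<lambda>i. ?g i + (if i \<in> F then - ?g i else 0)) has_sum (infsum ?g I + - sum ?g F)) I"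
    by (intro has_sum_add has_sum_infsum ell2_summable c)
  then have "infsum (\<lambda>i. ?g i + (if i \<in> F then - ?g i else 0)) I = infsum ?g I - sum ?g F"
    using infsumI by fastforce
  moreover have "(\<lambda>i. (cmod (c i - ell2_proj F c i))\<^sup>2) = (\<lambda>i. ?g i + (if i \<in> F then - ?g i else 0))"
    by (auto simp: ell2_proj_def)
  ultimately show ?thesis by (simp add: ell2_norm_def)
qed

section \<open>The synthesis operator as an unconditionally convergent series\<close>

context krein_space
begin

context
  fixes I :: "'i set" and f :: "'i \<Rightarrow> 'a" and T :: "('i \<Rightarrow> complex) \<Rightarrow> 'a"
  assumes T: "synthesis_operator I f T"
begin

lemma synthesis_add: "c \<in> ell2 I \<Longrightarrow> d \<in> ell2 I \<Longrightarrow> T (\<lambda>i. c i + d i) = T c + T d"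
  and synthesis_scale: "c \<in> ell2 I \<Longrightarrow> T (\<lambda>i. a * c i) = scaleC a (T c)"
  and synthesis_basis: "i \<in> I \<Longrightarrow> T (ell2_basis i) = f i"
  using T by (auto simp: synthesis_operator_def)

lemma synthesis_bounded:
  obtains C where "C \<ge> 0" "\<And>c. c \<in> ell2 I \<Longrightarrow> norm (T c) \<le> C * ell2_norm I c"
proof -
  obtain C where C: "\<And>c. c \<in> ell2 I \<Longrightarrow> norm (T c) \<le> C * ell2_norm I c"
    using T unfolding synthesis_operator_def by metis
  have "ell2_norm I c \<ge> 0" for c :: "'i \<Rightarrow> complex"
    by (simp add: ell2_norm_def infsum_nonneg)
  then have "C * ell2_norm I c \<le> \<bar>C\<bar> * ell2_norm I c" for c :: "'i \<Rightarrow> complex"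
    by (intro mult_right_mono) auto
  then have "norm (T c) \<le> \<bar>C\<bar> * ell2_norm I c" if "c \<in> ell2 I" for c
    using C[OF that] order_trans by blast
  then show ?thesis using that[of "\<bar>C\<bar>"] by simp
qed

lemma synthesis_diff:
  assumes "c \<in> ell2 I" "d \<in> ell2 I"
  shows "T (\<lambda>i. c i - d i) = T c - T d"
  using synthesis_add[OF assms(1) ell2_mult[OF assms(2), of "- 1"]] synthesis_scale[OF assms(2), of "- 1"]
  by simp

lemma synthesis_cutoff:
  assumes "finite F" "F \<subseteq> I"
  shows "ell2_proj F c \<in> ell2 I \<and> T (ell2_proj F c) = (\<Sum>i\<in>F. scaleC (c i) (f i))"
  using assms
proof (induction F rule: finite_induct)
  case empty
  have z: "(\<lambda>i. 0) \<in> ell2 I" by (simp add: ell2_def)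
  have "T (\<lambda>i. 0) = 0" using synthesis_scale[OF z, of 0] by simp
  then show ?case using z by (simp add: ell2_proj_def)
next
  case (insert j F)
  have j: "j \<in> I" using insert by simp
  have eq: "ell2_proj (insert j F) c = (\<lambda>i. c j * ell2_basis j i + ell2_proj F c i)"
    using insert(2) by (auto simp: ell2_proj_def ell2_basis_def)
  have in1: "(\<lambda>i. c j * ell2_basis j i) \<in> ell2 I" using ell2_mult ell2_basis_in_ell2[OF j] by blast
  have "T (ell2_proj (insert j F) c) = scaleC (c j) (f j) + T (ell2_proj F c)"
    unfolding eq
    using synthesis_add[OF in1] insert synthesis_scale[OF ell2_basis_in_ell2[OF j]] synthesis_basis[OF j] by simp
  then show ?case
    using insert ell2_add[OF in1] by (simp add: eq)
qed

text \<open>The synthesis operator is known only by linearity, boundedness and its values on the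
  basis. The error of a partial sum is the image of a tail of c, whose norm tends to 0.\<close>

lemma synthesis_has_sum:
  assumes c: "c \<in> ell2 I"
  shows "((\<lambda>i. scaleC (c i) (f i)) has_sum T c) I"
proof -
  let ?g = "\<lambda>i. (cmod (c i))\<^sup>2"
  obtain C where C: "\<And>c. c \<in> ell2 I \<Longrightarrow> norm (T c) \<le> C * ell2_norm I c"
    using synthesis_bounded by blast
  have "(?g has_sum infsum ?g I) I" using ell2_summable[OF c] by simp
  then have "((\<lambda>F. C * sqrt (infsum ?g I - sum ?g F)) \<longlongrightarrow> C * sqrt (infsum ?g I - infsum ?g I))
      (finite_subsets_at_top I)"
    unfolding has_sum_def by (intro tendsto_intros)
  then have lim: "((\<lambda>F. C * sqrt (infsum ?g I - sum ?g F)) \<longlongrightarrow> 0) (finite_subsets_at_top I)"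
    by simp
  have "((\<lambda>F. (\<Sum>i\<in>F. scaleC (c i) (f i)) - T c) \<longlongrightarrow> 0) (finite_subsets_at_top I)"
  proof (rule Lim_null_comparison[OF eventually_finite_subsets_at_top_weakI lim])
    fix F assume F: "finite F" "F \<subseteq> I"
    have "norm ((\<Sum>i\<in>F. scaleC (c i) (f i)) - T c) = norm (T (\<lambda>i. c i - ell2_proj F c i))"
      using synthesis_cutoff[OF F, of c] synthesis_diff[OF c] by (simp add: norm_minus_commute)
    also have "\<dots> \<le> C * ell2_norm I (\<lambda>i. c i - ell2_proj F c i)"
      using C ell2_diff[OF c ell2_proj_in_ell2[OF c]] by blast
    finally show "norm ((\<Sum>i\<in>F. scaleC (c i) (f i)) - T c) \<le> C * sqrt (infsum ?g I - sum ?g F)"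
      by (simp add: ell2_norm_cutoff[OF c F])
  qed
  then show ?thesis unfolding has_sum_def by (simp add: LIM_zero_iff)
qed

lemma form_synthesis_has_sum:
  "c \<in> ell2 I \<Longrightarrow> ((\<lambda>i. c i * form (f i) x) has_sum form (T c) x) I"
  using has_sum_bounded_linear[OF bounded_linear_form_left synthesis_has_sum]
  by (simp add: form_scale)

text \<open>Once T is onto, every y has the form T c, and this becomes the pointwise bound that the
  Baire argument makes uniform.\<close>

lemma norm_form_synthesis_le:
  assumes "c \<in> ell2 I" and "(\<lambda>i. (cmod (form x (f i)))\<^sup>2) summable_on I"
  shows "cmod (form x (T c)) \<le> ell2_norm I c * sqrt (\<Sum>\<^sub>\<infinity>i\<in>I. (cmod (form x (f i)))\<^sup>2)"
proof -
  have eq: "cmod (form y z) = cmod (form z y)" for y z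
    by (subst form_herm) simp
  show ?thesis
    using has_sum_mult_norm_le[OF form_synthesis_has_sum[OF assms(1)] ell2_summable[OF assms(1)], of x] assms(2)
    by (simp add: ell2_norm_def eq[of _ x])
qed

end

section \<open>The J-frame operator: convergence, boundedness, symmetry\<close>

lemma bessel_family_form:
  assumes "bessel_family I f"
  obtains B where "\<And>x. (\<lambda>i. (cmod (form x (f i)))\<^sup>2) summable_on I"
    and "\<And>x. (\<Sum>\<^sub>\<infinity>i\<in>I. (cmod (form x (f i)))\<^sup>2) \<le> B * (norm x)\<^sup>2"
proof -
  obtain B where "\<And>x. (\<lambda>i. (cmod (ip x (f i)))\<^sup>2) summable_on I \<and>
      (\<Sum>\<^sub>\<infinity>i\<in>I. (cmod (ip x (f i)))\<^sup>2) \<le> B * (norm x)\<^sup>2"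
    using assms unfolding bessel_family_def by blast
  \<comment> \<open>Substituting \<open>J x\<close> turns \<open>ip\<close> into \<open>form\<close>
    and preserves the norm, so the Bessel bound B is kept.\<close>
  from this[of "J _"] show ?thesis using that[of B] by (simp add: ip_eq_form_J)
qed

context
  fixes I :: "'i set" and f :: "'i \<Rightarrow> 'a"
  assumes frame: "J_frame I f"
begin

text \<open>The signed analysis operator: the J-frame operator is synthesis applied to it. The value
  0 off I is what membership in \<open>ell2 I\<close> demands.\<close>

definition coefficients :: "'a \<Rightarrow> 'i \<Rightarrow> complex" where
  "coefficients x = (\<lambda>i. if i \<in> I then sig f i * form x (f i) else 0)"

lemma cnj_sig [simp]: "cnj (sig f i) = sig f i"
  by (simp add: sig_def)

lemma cmod_sig_le: "cmod (sig f i) \<le> 1"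
  by (simp add: sig_def sgn_if)

lemma analysis_summable: "(\<lambda>i. (cmod (form x (f i)))\<^sup>2) summable_on I"
  using frame bessel_family_form unfolding J_frame_def by metis

lemma cmod_coefficients_le: "i \<in> I \<Longrightarrow> (cmod (coefficients x i))\<^sup>2 \<le> (cmod (form x (f i)))\<^sup>2"
  using cmod_sig_le[of i] unfolding coefficients_def
  by (intro power_mono) (auto simp: norm_mult intro: mult_left_le_one_le)

lemma coefficients_in_ell2: "coefficients x \<in> ell2 I"
proof -
  have "(\<lambda>i. (cmod (coefficients x i))\<^sup>2) summable_on I"
    by (rule summable_on_comparison_test[OF analysis_summable[of x] cmod_coefficients_le]) simp_all
  then show ?thesis by (simp add: ell2_def coefficients_def)
qed

lemma J_frame_operator_eq:
  assumes "synthesis_operator I f T"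
  shows "((\<lambda>i. scaleC (sig f i * form x (f i)) (f i)) has_sum T (coefficients x)) I"
    and "J_frame_operator I f x = T (coefficients x)"
proof -
  show *: "((\<lambda>i. scaleC (sig f i * form x (f i)) (f i)) has_sum T (coefficients x)) I"
    using synthesis_has_sum[OF assms coefficients_in_ell2, of x]
    by (rule has_sum_cong[THEN iffD1, rotated]) (simp add: coefficients_def)
  show "J_frame_operator I f x = T (coefficients x)"
    unfolding J_frame_operator_def using infsumI[OF *] .
qed

lemma J_frame_operator_has_sum:
  "((\<lambda>i. scaleC (sig f i * form x (f i)) (f i)) has_sum J_frame_operator I f x) I"
proof -
  obtain T where T: "synthesis_operator I f T" using frame by (auto simp: J_frame_def)
  then show ?thesis using J_frame_operator_eq[OF T, of x] by simp
qed

lemma J_frame_operator_add: "J_frame_operator I f (x + y) = J_frame_operator I f x + J_frame_operator I f y"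
  using has_sum_add[OF J_frame_operator_has_sum J_frame_operator_has_sum, of x y]
  by (intro has_sum_unique[OF J_frame_operator_has_sum])
    (simp add: form_add distrib_left scale_left_distrib)

lemma J_frame_operator_scale: "J_frame_operator I f (scaleC a x) = scaleC a (J_frame_operator I f x)"
  using has_sum_bounded_linear[OF bounded_linear_scaleC J_frame_operator_has_sum, of a x]
  by (intro has_sum_unique[OF J_frame_operator_has_sum])
    (simp add: form_scale mult.left_commute)

lemma bounded_linear_J_frame_operator: "bounded_linear (J_frame_operator I f)"
proof -
  obtain T where T: "synthesis_operator I f T" using frame by (auto simp: J_frame_def)
  obtain C where C: "C \<ge> 0" "\<And>c. c \<in> ell2 I \<Longrightarrow> norm (T c) \<le> C * ell2_norm I c"
    using synthesis_bounded[OF T] by blast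
  obtain B where B: "\<And>x. (\<Sum>\<^sub>\<infinity>i\<in>I. (cmod (form x (f i)))\<^sup>2) \<le> B * (norm x)\<^sup>2"
    using frame bessel_family_form unfolding J_frame_def by metis
  show ?thesis
  proof (rule bounded_linear_intro)
    fix x
    have "ell2_norm I (coefficients x) \<le> sqrt (\<Sum>\<^sub>\<infinity>i\<in>I. (cmod (form x (f i)))\<^sup>2)"
      unfolding ell2_norm_def
      by (intro real_sqrt_le_mono infsum_mono ell2_summable coefficients_in_ell2 analysis_summable
          cmod_coefficients_le)
    also have "\<dots> \<le> sqrt (B * (norm x)\<^sup>2)" by (intro real_sqrt_le_mono B)
    finally have "ell2_norm I (coefficients x) \<le> sqrt B * norm x" by (simp add: real_sqrt_mult)
    then have "C * ell2_norm I (coefficients x) \<le> C * (sqrt B * norm x)"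
      using C(1) by (rule mult_left_mono)
    then show "norm (J_frame_operator I f x) \<le> norm x * (C * sqrt B)"
      using C(2)[OF coefficients_in_ell2, of x] J_frame_operator_eq(2)[OF T, of x]
      by (simp add: algebra_simps)
  qed (simp_all add: J_frame_operator_add J_frame_operator_scale scaleR_eq)
qed

text \<open>The signs are real, so expanding either side gives the same series of sigma_i [x, f_i]
  [f_i, y].\<close>

lemma form_J_frame_operator_symmetric:
  "form (J_frame_operator I f x) y = form x (J_frame_operator I f y)"
proof (rule has_sum_unique)
  show "((\<lambda>i. sig f i * form x (f i) * form (f i) y) has_sum form (J_frame_operator I f x) y) I"
    using has_sum_bounded_linear[OF bounded_linear_form_left J_frame_operator_has_sum, of x y]
    by (simp add: form_scale)
  have "cnj (form y (f i)) = form (f i) y" for i using form_herm[of y "f i"] by simp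
  then show "((\<lambda>i. sig f i * form x (f i) * form (f i) y) has_sum form x (J_frame_operator I f y)) I"
    using has_sum_bounded_linear[OF bounded_linear_form_right J_frame_operator_has_sum, of x y]
    by (simp add: form_scale_right mult_ac)
qed

section \<open>Surjectivity of synthesis and lower bounds\<close>

lemma J_frame_synthesis_surj:
  assumes T: "synthesis_operator I f T"
    and M: "maximal_uniformly_positive ((T \<circ> ell2_proj (index_p I f)) ` ell2 I)"
    and N: "maximal_uniformly_negative ((T \<circ> ell2_proj (index_m I f)) ` ell2 I)"
  obtains c where "c \<in> ell2 I" "y = T c"
proof -
  obtain u v where uv: "y = u + v" "u \<in> (T \<circ> ell2_proj (index_p I f)) ` ell2 I"
    "v \<in> (T \<circ> ell2_proj (index_m I f)) ` ell2 I"
    using maximal_definite_sum_UNIV M N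
    unfolding maximal_uniformly_positive_iff maximal_uniformly_negative_iff by metis
  then obtain c d where "c \<in> ell2 I" "d \<in> ell2 I"
    "y = T (ell2_proj (index_p I f) c) + T (ell2_proj (index_m I f) d)" by auto
  then show ?thesis using that synthesis_add[OF T] ell2_add ell2_proj_in_ell2 by metis
qed

text \<open>
  The functionals \<open>form x\<close> with normalised analysis coefficients are pointwise bounded because the
  synthesis operator is onto; the Baire category theorem makes the bound uniform.
\<close>

lemma J_frame_lower_bound:
  obtains C where "C \<ge> 0" "\<And>x. norm x \<le> C * sqrt (\<Sum>\<^sub>\<infinity>i\<in>I. (cmod (form x (f i)))\<^sup>2)"
proof -
  obtain T where T: "synthesis_operator I f T"
    "maximal_uniformly_positive ((T \<circ> ell2_proj (index_p I f)) ` ell2 I)"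
    "maximal_uniformly_negative ((T \<circ> ell2_proj (index_m I f)) ` ell2 I)"
    using frame unfolding J_frame_def by blast
  define A where "A x = sqrt (\<Sum>\<^sub>\<infinity>i\<in>I. (cmod (form x (f i)))\<^sup>2)" for x
  have A0: "A x \<ge> 0" for x by (simp add: A_def infsum_nonneg)
  \<comment> \<open>Each \<open>E n\<close> is closed as an intersection over x of closed sets, and
    y = T c belongs to \<open>E n\<close> as soon as n is at least the norm of c.\<close>
  define E where "E n = {y. \<forall>x. cmod (form x y) \<le> real n * A x}" for n :: nat
  have "closed (E n)" for n
    unfolding E_def
    by (intro closed_Collect_all closed_Collect_le continuous_intros
        bounded_linear.continuous_on[OF bounded_linear_form_right])
  moreover have "y \<in> \<Union> (range E)" for y
  proof -
    obtain c where c: "c \<in> ell2 I" "y = T c" using J_frame_synthesis_surj[OF T] by blast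
    define n where "n = nat \<lceil>ell2_norm I c\<rceil>"
    have n: "ell2_norm I c \<le> real n" unfolding n_def by linarith
    have "cmod (form x y) \<le> real n * A x" for x
    proof -
      have "cmod (form x y) \<le> ell2_norm I c * A x"
        unfolding A_def c(2) by (rule norm_form_synthesis_le[OF T(1) c(1) analysis_summable])
      also have "\<dots> \<le> real n * A x" using n A0 by (rule mult_right_mono)
      finally show ?thesis .
    qed
    then show ?thesis by (auto simp: E_def)
  qed
  then have "\<Union> (range E) = UNIV" by blast
  ultimately have "\<exists>n. interior (E n) \<noteq> {}"
    using Met_TC.metric_Baire_category_alt[where ?'a = 'a, of "range E"] complete_UNIV_krein
    by auto
  then obtain n y0 where "y0 \<in> interior (E n)" by blast
  then obtain r where r: "r > 0" "ball y0 r \<subseteq> E n" by (meson mem_interior)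
  have "norm x \<le> 4 * real n / r * A x" for x
  proof (cases "x = 0")
    case False
    \<comment> \<open>With this t the point y is at distance r/2 from y0, hence in the ball.
      Subtracting the bounds at y and y0 isolates t [J x, x] = t |x|^2 = r |x| / 2, at most 2 n A x;
      this is the origin of 4 n / r.\<close>
    define t where "t = r / (2 * norm x)"
    have t: "t > 0" using False r by (simp add: t_def)
    define y where "y = y0 + t *\<^sub>R J x"
    have "y0 \<in> E n" "y \<in> E n"
      using r False by (auto simp: y_def t_def dist_norm intro!: subsetD[OF r(2)])
    then have "cmod (form x y - form x y0) \<le> real n * A x + real n * A x"
      unfolding E_def by (intro order_trans[OF norm_triangle_ineq4] add_mono) auto
    also have "form x y - form x y0 = t * form (J x) x"
      by (simp add: y_def form_add_right scaleR_eq form_scale_right form_J_left)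
    also have "cmod \<dots> = t * (norm x)\<^sup>2"
    proof -
      have "form (J x) x = complex_of_real ((norm x)\<^sup>2)"
        using form_herm[of x "J x"] form_J_left[of x x]
        by (simp add: complex_eq_iff norm_square)
      then show ?thesis using t by (simp add: norm_mult norm_power)
    qed
    also have "\<dots> = r * norm x / 2"
      using False by (simp add: t_def power2_eq_square)
    finally have "r * norm x / 2 \<le> real n * A x + real n * A x" .
    then have "r * norm x \<le> 4 * (real n * A x)" by linarith
    then show ?thesis using r(1) by (simp add: pos_le_divide_eq mult.commute[of r] mult.assoc)
  qed (use A0 r(1) in auto)
  moreover have "4 * real n / r \<ge> 0" using r(1) by simp
  ultimately show ?thesis using that unfolding A_def by blast
qed

lemma J_frame_operator_bounded_below:
  obtains K where "K > 0" "\<And>x. norm x \<le> K * norm (J_frame_operator I f x)"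
proof -
  obtain T where T: "synthesis_operator I f T"
    and M: "maximal_uniformly_positive ((T \<circ> ell2_proj (index_p I f)) ` ell2 I)"
    and N: "maximal_uniformly_negative ((T \<circ> ell2_proj (index_m I f)) ` ell2 I)"
    using frame unfolding J_frame_def by blast
  let ?Pp = "ell2_proj (index_p I f)" and ?Pm = "ell2_proj (index_m I f)"
  define A where "A x = (\<Sum>\<^sub>\<infinity>i\<in>I. (cmod (form x (f i)))\<^sup>2)" for x
  obtain C where C: "C \<ge> 0" "\<And>x. norm x \<le> C * sqrt (A x)"
    using J_frame_lower_bound unfolding A_def by blast
  have dM: "uniformly_definite 1 ((T \<circ> ?Pp) ` ell2 I)" and dN: "uniformly_definite (- 1) ((T \<circ> ?Pm) ` ell2 I)"
    using M N unfolding maximal_uniformly_positive_iff maximal_uniformly_negative_iff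
      maximal_uniformly_definite_def by auto
  obtain K where K: "K > 0" "\<And>u v. u \<in> (T \<circ> ?Pp) ` ell2 I \<Longrightarrow> v \<in> (T \<circ> ?Pm) ` ell2 I
      \<Longrightarrow> norm u + norm v \<le> K * norm (u + v)"
    using norm_add_uniformly_definite_ge[OF dM dN] by blast
  \<comment> \<open>Needed because sigma_i = 0 at a neutral f_i would lose the term |[x, f_i]|^2;
    since f_i = 0, that term vanishes too.\<close>
  have neutral: "f i = 0" if i: "i \<in> I" "Re (form (f i) (f i)) = 0" for i
  proof -
    have "?Pp (ell2_basis i) = ell2_basis i"
      using i by (auto simp: ell2_proj_def ell2_basis_def index_p_def)
    then have "f i = (T \<circ> ?Pp) (ell2_basis i)" using synthesis_basis[OF T i(1)] by simp
    then have "f i \<in> (T \<circ> ?Pp) ` ell2 I" using ell2_basis_in_ell2[OF i(1)] by blast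
    then obtain \<alpha> where "\<alpha> > 0" "\<alpha> * (norm (f i))\<^sup>2 \<le> 0"
      using dM i unfolding uniformly_definite_def by force
    then show ?thesis by (simp add: mult_le_0_iff)
  qed
  \<comment> \<open>The estimate itself yields C^2 K; adding 1 keeps the constant positive if C =
    0.\<close>
  have "norm x \<le> (C\<^sup>2 * K + 1) * norm (J_frame_operator I f x)" for x
  proof (cases "x = 0")
    case False
    let ?c = "coefficients x"
    note c = coefficients_in_ell2[of x]
    note cp = ell2_proj_in_ell2[OF c, of "index_p I f"] and cm = ell2_proj_in_ell2[OF c, of "index_m I f"]
    define u v where "u = T (?Pp ?c)" and "v = T (?Pm ?c)"
    have "(\<lambda>i. ?Pp ?c i + ?Pm ?c i) = ?c"
      by (auto simp: ell2_proj_def index_p_def index_m_def coefficients_def)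
    then have sum: "u + v = J_frame_operator I f x"
      using synthesis_add[OF T cp cm] by (simp add: u_def v_def J_frame_operator_eq(2)[OF T])
    have "u \<in> (T \<circ> ?Pp) ` ell2 I" "v \<in> (T \<circ> ?Pm) ` ell2 I" using c by (auto simp: u_def v_def)
    then have uv: "norm u + norm v \<le> K * norm (J_frame_operator I f x)"
      using K(2) sum by metis
    \<comment> \<open>Reversing the sign of the negative part multiplies the coefficients by sigma_i
      once more, which leaves the unsigned [x, f_i] wherever f_i is not neutral.\<close>
    have "T (\<lambda>i. ?Pp ?c i - ?Pm ?c i) = u - v" using synthesis_diff[OF T cp cm] by (simp add: u_def v_def)
    then have hs: "((\<lambda>i. (?Pp ?c i - ?Pm ?c i) * form (f i) x) has_sum form (u - v) x) I"
      using form_synthesis_has_sum[OF T ell2_diff[OF cp cm], of x] by simp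
    have "(?Pp ?c i - ?Pm ?c i) * form (f i) x = complex_of_real ((cmod (form x (f i)))\<^sup>2)" if i: "i \<in> I" for i
    proof (cases "Re (form (f i) (f i)) = 0")
      case True
      then show ?thesis using neutral[OF i] by simp
    next
      case False
      then have "?Pp ?c i - ?Pm ?c i = form x (f i)"
        using i by (auto simp: ell2_proj_def index_p_def index_m_def coefficients_def sig_def)
      moreover have "form (f i) x = cnj (form x (f i))" by (rule form_herm)
      ultimately show ?thesis by (simp only: complex_norm_square)
    qed
    then have "((\<lambda>i. complex_of_real ((cmod (form x (f i)))\<^sup>2)) has_sum form (u - v) x) I"
      using hs by (simp cong: has_sum_cong)
    then have "((\<lambda>i. (cmod (form x (f i)))\<^sup>2) has_sum Re (form (u - v) x)) I"
      using has_sum_Re by fastforce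
    then have "A x = Re (form (u - v) x)" unfolding A_def by (rule infsumI)
    also have "\<dots> \<le> norm (u - v) * norm x" by (rule Re_form_le)
    also have "\<dots> \<le> K * norm (J_frame_operator I f x) * norm x"
      using order_trans[OF norm_triangle_ineq4 uv] by (rule mult_right_mono) simp
    finally have Ax: "A x \<le> K * norm (J_frame_operator I f x) * norm x" .
    have "(norm x)\<^sup>2 \<le> (C * sqrt (A x))\<^sup>2" using C(2) by (rule power_mono) simp
    also have "\<dots> = C\<^sup>2 * A x" by (simp add: power_mult_distrib A_def infsum_nonneg)
    also have "\<dots> \<le> C\<^sup>2 * (K * norm (J_frame_operator I f x) * norm x)"
      using Ax by (rule mult_left_mono) simp
    finally have "norm x * norm x \<le> (C\<^sup>2 * K * norm (J_frame_operator I f x)) * norm x"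
      by (simp add: power2_eq_square mult_ac)
    then have "norm x \<le> C\<^sup>2 * K * norm (J_frame_operator I f x)"
      using False by (simp add: mult_le_cancel_right)
    then show ?thesis by (simp add: distrib_right add_increasing2)
  qed (use K(1) in simp)
  moreover have "C\<^sup>2 * K + 1 > 0" using K(1) by (simp add: add_nonneg_pos)
  ultimately show ?thesis using that by blast
qed

section \<open>Invertibility and the two expansions\<close>

lemma bij_J_frame_operator: "bij (J_frame_operator I f)"
proof (rule bijI)
  obtain K where K: "K > 0" "\<And>x. norm x \<le> K * norm (J_frame_operator I f x)"
    using J_frame_operator_bounded_below by blast
  interpret S: bounded_linear "J_frame_operator I f" by (rule bounded_linear_J_frame_operator)
  have ker: "x = 0" if "J_frame_operator I f x = 0" for x
    using K(2)[of x] unfolding that by simp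
  show "inj (J_frame_operator I f)"
  proof (rule injI)
    fix x y assume "J_frame_operator I f x = J_frame_operator I f y"
    then have "J_frame_operator I f (x - y) = 0" by (simp add: S.diff)
    then have "x - y = 0" by (rule ker)
    then show "x = y" by simp
  qed
  have "complete (range (J_frame_operator I f))"
  proof (rule complete_isometric_image)
    show "inverse K > 0" using K(1) by simp
    show "\<forall>x\<in>UNIV. norm (J_frame_operator I f x) \<ge> inverse K * norm x"
    proof
      fix x
      show "norm (J_frame_operator I f x) \<ge> inverse K * norm x"
        using K(2)[of x] K(1) by (simp add: inverse_eq_divide pos_divide_le_eq mult.commute)
    qed
  qed (simp_all add: bounded_linear_J_frame_operator complete_UNIV_krein)
  then have cl: "closed (range (J_frame_operator I f))" by (rule complete_imp_closed)
  have sub: "subspace (range (J_frame_operator I f))"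
  proof (rule subspaceI)
    show "0 \<in> range (J_frame_operator I f)" using rangeI[of "J_frame_operator I f" 0] unfolding S.zero .
  next
    fix x y assume "x \<in> range (J_frame_operator I f)" "y \<in> range (J_frame_operator I f)"
    then show "x + y \<in> range (J_frame_operator I f)" using J_frame_operator_add[symmetric] by auto
  next
    fix c x assume "x \<in> range (J_frame_operator I f)"
    then show "scaleC c x \<in> range (J_frame_operator I f)" using J_frame_operator_scale[symmetric] by auto
  qed
  show "surj (J_frame_operator I f)"
  proof (rule ccontr)
    assume "\<not> surj (J_frame_operator I f)"
    then obtain z where z: "z \<notin> range (J_frame_operator I f)" by blast
    obtain u where u: "u \<noteq> 0" "\<And>y. y \<in> range (J_frame_operator I f) \<Longrightarrow> form u y = 0"
      using ex_form_orthogonal[OF sub cl z] by metis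
    \<comment> \<open>By symmetry, |S u|^2 = [J S u, S u] equals [u, S (J S u)], and u is orthogonal
      to the range; so u lies in the kernel.\<close>
    have "form (J (J_frame_operator I f u)) (J_frame_operator I f u) = 0"
      unfolding form_J_left[of "J_frame_operator I f u"] form_J_frame_operator_symmetric[of u] by (rule u(2)[OF rangeI])
    then have "J_frame_operator I f u = 0"
      using norm_square[of "J_frame_operator I f u"] by simp
    then show False using ker u(1) by blast
  qed
qed

text \<open>Boundedness is what allows the inverse to be moved inside the infinite sum in the second
  expansion; it is the lower bound for S read at \<open>inv S x\<close>.\<close>

lemma bounded_linear_inv_J_frame_operator: "bounded_linear (inv (J_frame_operator I f))"
proof -
  obtain K where K: "\<And>x. norm x \<le> K * norm (J_frame_operator I f x)"
    using J_frame_operator_bounded_below by blast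
  let ?S = "J_frame_operator I f"
  interpret S: bounded_linear ?S by (rule bounded_linear_J_frame_operator)
  have inv: "inv ?S (?S x) = x" "?S (inv ?S x) = x" for x
    using bij_J_frame_operator by (simp_all add: bij_is_inj bij_is_surj surj_f_inv_f)
  show ?thesis
  proof (rule bounded_linear_intro)
    show "inv ?S (x + y) = inv ?S x + inv ?S y" for x y
      by (metis S.add inv)
    show "inv ?S (r *\<^sub>R x) = r *\<^sub>R inv ?S x" for r x
      by (metis S.scaleR inv)
    show "norm (inv ?S x) \<le> norm x * K" for x
      using K[of "inv ?S x"] by (simp add: inv mult.commute)
  qed
qed

lemma J_frame_reconstruction:
  fixes x :: 'a
  defines "S \<equiv> J_frame_operator I f"
  shows "((\<lambda>i. scaleC (sig f i * form x (inv S (f i))) (f i)) has_sum x) I"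
    and "((\<lambda>i. scaleC (sig f i * form x (f i)) (inv S (f i))) has_sum x) I"
proof -
  have inv: "inv S (S y) = y" "S (inv S y) = y" for y
    using bij_J_frame_operator by (simp_all add: S_def bij_is_inj bij_is_surj surj_f_inv_f)
  \<comment> \<open>The inverse inherits symmetry from S, so the series for S at
    \<open>inv S x\<close> is the first expansion.\<close>
  have "form (inv S x) y = form x (inv S y)" for y
    using form_J_frame_operator_symmetric[of "inv S x" "inv S y", folded S_def] by (simp add: inv)
  then show "((\<lambda>i. scaleC (sig f i * form x (inv S (f i))) (f i)) has_sum x) I"
    using J_frame_operator_has_sum[of "inv S x", folded S_def] by (simp add: inv)
  have "inv S (scaleC a y) = scaleC a (inv S y)" for a y
    using J_frame_operator_scale[of a "inv S y", folded S_def] by (metis inv)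
  then show "((\<lambda>i. scaleC (sig f i * form x (f i)) (inv S (f i))) has_sum x) I"
    using has_sum_bounded_linear[OF bounded_linear_inv_J_frame_operator J_frame_operator_has_sum[of x], folded S_def]
    by (simp add: inv)
qed

end

end

theorem mainTheorem4:
  fixes scaleC :: "complex \<Rightarrow> 'a::real_normed_vector \<Rightarrow> 'a"
    and form :: "'a \<Rightarrow> 'a \<Rightarrow> complex"
    and Hp Hm :: "'a set"
    and I :: "'i set"
    and f :: "'i \<Rightarrow> 'a"
    and S :: "'a \<Rightarrow> 'a"
    and \<sigma> :: "'i \<Rightarrow> complex"
  assumes "krein_space scaleC form Hp Hm"
    and "krein_space.J_frame scaleC form Hp Hm I f"
    and "S = krein_space.J_frame_operator scaleC form I f"
    and "\<sigma> = krein_space.sig form f"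
  shows "\<forall>x. ((\<lambda>i. scaleC (\<sigma> i * form x (inv S (f i))) (f i)) has_sum x) I \<and>
             ((\<lambda>i. scaleC (\<sigma> i * form x (f i)) (inv S (f i))) has_sum x) I"
proof -
  interpret krein_space scaleC form Hp Hm by fact
  show ?thesis
    unfolding assms(3,4) using J_frame_reconstruction[OF assms(2)] by blast
qed

end
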